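(* Let $\theta>0$ be a real number and let $T$ be an equilateral triangle with side length $\theta$ in the Euclidean plane. Suppose $\theta$ is good, i.e. there exists a point $M$ in the plane of $T$ whose distances to all three vertices of $T$ are rational numbers. Then $\theta$ is bi-quadric; more precisely, $\theta^2=\alpha+\sqrt{\beta}$ or $\theta^2=\alpha-\sqrt{\beta}$ for some rational numbers $\alpha,\beta$ with $\beta\ge 0$ and $\alpha>0$.
   Context: A positive real number $\theta$ is called "good" if, for the equilateral triangle $T$ with side length $\theta$, there is a point in the plane of $T$ that is at rational distance from all three vertices of $T$. A number is bi-quadric if it is a positive root of an equation $x^4+ux^2+v=0$ with $u,v\in\mathbb{Q}$. *)

theory Defs
  imports "HOL-Analysis.Analysis"
begin

definition equilateral_triangle :: "real \<Rightarrow> real^2 \<Rightarrow> real^2 \<Rightarrow> real^2 \<Rightarrow> bool" where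
  "equilateral_triangle \<theta> A B C \<longleftrightarrow>
     \<theta> > 0 \<and> dist A B = \<theta> \<and> dist B C = \<theta> \<and> dist C A = \<theta>"

text \<open>The equilateral triangle of side \<open>\<theta>\<close> is unique up to congruence, so quantifying
  existentially over its position in the plane expresses ``for the equilateral triangle''.\<close>

definition good :: "real \<Rightarrow> bool" where
  "good \<theta> \<longleftrightarrow> (\<exists>A B C. equilateral_triangle \<theta> A B C \<and>
     (\<exists>M. dist M A \<in> \<rat> \<and> dist M B \<in> \<rat> \<and> dist M C \<in> \<rat>))"

definition bi_quadric :: "real \<Rightarrow> bool" where
  "bi_quadric x \<longleftrightarrow> x > 0 \<and> (\<exists>u\<in>\<rat>. \<exists>v\<in>\<rat>. x ^ 4 + u * x ^ 2 + v = 0)"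

end

theory Submission
  imports Defs
begin

text \<open>
  If a point has distances \<open>a, b, c\<close> from the vertices of an equilateral triangle of side \<open>\<theta>\<close>, then
  \<open>3 (a\<^sup>4 + b\<^sup>4 + c\<^sup>4 + \<theta>\<^sup>4) = (a\<^sup>2 + b\<^sup>2 + c\<^sup>2 + \<theta>\<^sup>2)\<^sup>2\<close>: three vectors in the plane have
  vanishing Gram determinant, and the Gram matrix of the vectors from one vertex to the other two
  and to the point is expressed by the four lengths. For rational \<open>a, b, c\<close> this is a monic
  quadratic equation for \<open>\<theta>\<^sup>2\<close> with rational coefficients, and completing the square solves it.
\<close>

lemma gram_det_plane_eq_0:
  fixes v w x :: "real^2"
  shows "(v \<bullet> v) * ((w \<bullet> w) * (x \<bullet> x) - (w \<bullet> x)\<^sup>2)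
       - (v \<bullet> w) * ((v \<bullet> w) * (x \<bullet> x) - (w \<bullet> x) * (v \<bullet> x))
       + (v \<bullet> x) * ((v \<bullet> w) * (w \<bullet> x) - (w \<bullet> w) * (v \<bullet> x)) = 0"
  unfolding inner_vec_def sum_2 inner_real_def by algebra

text \<open>Polarization (law of cosines): it turns every entry of the Gram matrix into
  lengths.\<close>

lemma inner_diff_eq_dist:
  fixes p q r :: "'a::real_inner"
  shows "(q - p) \<bullet> (r - p) = ((dist p q)\<^sup>2 + (dist p r)\<^sup>2 - (dist q r)\<^sup>2) / 2"
  by (simp add: dist_norm power2_norm_eq_inner inner_diff_left inner_diff_right inner_commute)

lemma equilateral_triangle_distances:
  assumes "equilateral_triangle \<theta> A B C"
  shows "3 * ((dist M A)^4 + (dist M B)^4 + (dist M C)^4 + \<theta>^4)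
       = ((dist M A)\<^sup>2 + (dist M B)\<^sup>2 + (dist M C)\<^sup>2 + \<theta>\<^sup>2)\<^sup>2"
proof -
  define s a b c where "s = \<theta>\<^sup>2" and "a = (dist M A)\<^sup>2" and "b = (dist M B)\<^sup>2" and "c = (dist M C)\<^sup>2"
  note abc = s_def a_def b_def c_def
  from assms have sides: "\<theta> > 0" "dist A B = \<theta>" "dist B C = \<theta>" "dist A C = \<theta>"
    by (auto simp: equilateral_triangle_def dist_commute)
  have gram: "(B - A) \<bullet> (B - A) = s" "(C - A) \<bullet> (C - A) = s" "(M - A) \<bullet> (M - A) = a"
    "(B - A) \<bullet> (C - A) = s / 2"
    "(B - A) \<bullet> (M - A) = (s + a - b) / 2" "(C - A) \<bullet> (M - A) = (s + a - c) / 2"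
    by (simp_all add: inner_diff_eq_dist sides abc dist_commute)
  \<comment> \<open>The left side is -8 times the Gram determinant.\<close>
  have "s * (3 * (a\<^sup>2 + b\<^sup>2 + c\<^sup>2 + s\<^sup>2) - (a + b + c + s)\<^sup>2) = 0"
    using gram_det_plane_eq_0[of "B - A" "C - A" "M - A"] unfolding gram
    by (simp add: field_simps power2_eq_square)
  moreover have "s \<noteq> 0"
    using sides by (simp add: s_def)
  ultimately show ?thesis
    by (simp add: abc flip: power_mult)
qed

lemma sqrt_power2_cases:
  fixes x a :: real
  shows "x = a + sqrt ((x - a)\<^sup>2) \<or> x = a - sqrt ((x - a)\<^sup>2)"
  by (auto simp: abs_if)

theorem theorem0:
  fixes \<theta> :: real
  assumes "\<theta> > 0"
    and "good \<theta>"
  shows "bi_quadric \<theta> \<and>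
    (\<exists>\<alpha>\<in>\<rat>. \<exists>\<beta>\<in>\<rat>. \<alpha> > 0 \<and> \<beta> \<ge> 0 \<and>
       (\<theta>\<^sup>2 = \<alpha> + sqrt \<beta> \<or> \<theta>\<^sup>2 = \<alpha> - sqrt \<beta>))"
proof -
  from assms(2) obtain A B C M where tri: "equilateral_triangle \<theta> A B C"
    and rat: "dist M A \<in> \<rat>" "dist M B \<in> \<rat>" "dist M C \<in> \<rat>"
    unfolding good_def by blast
  define S where "S = (dist M A)\<^sup>2 + (dist M B)\<^sup>2 + (dist M C)\<^sup>2"
  \<comment> \<open>Constant term once \<open>3 * \<theta>^4 - \<theta>^4\<close> is collected and
    the relation halved.\<close>
  define v where "v = (3 * ((dist M A)^4 + (dist M B)^4 + (dist M C)^4) - S\<^sup>2) / 2"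
  have S_rat: "S \<in> \<rat>" and v_rat: "v \<in> \<rat>"
    using rat by (simp_all add: S_def v_def)
  \<comment> \<open>\<open>M\<close> cannot coincide with both \<open>A\<close> and
    \<open>B\<close>, so \<open>S\<close>, and with it \<alpha> = \<open>S / 2\<close>, is
    positive.\<close>
  have "A \<noteq> B"
    using tri by (auto simp: equilateral_triangle_def)
  then have "(dist M A)\<^sup>2 + (dist M B)\<^sup>2 > 0"
    by (metis dist_eq_0_iff sum_power2_gt_zero_iff)
  then have "S > 0"
    unfolding S_def by (simp add: add_pos_nonneg)
  have quartic: "\<theta>^4 + (- S) * \<theta>\<^sup>2 + v = 0"
    using equilateral_triangle_distances[OF tri, of M]
    unfolding v_def S_def[symmetric] by (simp add: field_simps power2_eq_square power4_eq_xxxx)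
  then have "(\<theta>\<^sup>2 - S / 2)\<^sup>2 = S\<^sup>2 / 4 - v"
    by (simp add: power2_diff field_simps)
  then have "(\<theta>\<^sup>2 - S / 2)\<^sup>2 \<in> \<rat>"
    using S_rat v_rat by simp
  moreover have "bi_quadric \<theta>"
    unfolding bi_quadric_def using assms(1) quartic S_rat v_rat Rats_minus_iff by blast
  \<comment> \<open>Taking \<beta> as the square itself makes \<beta> \<ge> 0 immediate; the sign
    before the root is that of \<open>\<theta>\<^sup>2 - S / 2\<close>.\<close>
  ultimately show ?thesis
    using sqrt_power2_cases[of "\<theta>\<^sup>2" "S / 2"] \<open>S > 0\<close> S_rat
    by (intro conjI bexI[of _ "S / 2"] bexI[of _ "(\<theta>\<^sup>2 - S / 2)\<^sup>2"]) simp_all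
qed

end
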